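(* If $\kappa$ is an uncountable cardinal, then any union of at most $\omega_1$ many nowhere dense subsets of $(2^{\kappa})_\delta$ is a boundary set, i.e. its complement is dense in $(2^\kappa)_\delta$.
   Context: For a $T_1$-space $X$, the $G_\delta$-modification $(X)_\delta$ is the set $X$ endowed with the topology generated by all $G_\delta$-subsets of $X$. $2^{\kappa}=\{0,1\}^{\kappa}$ carries the product topology ($\{0,1\}$ discrete), and $(2^{\kappa})_\delta$ is its $G_\delta$-modification; a base consists of the sets $[f]=\{g\in 2^\kappa : f\subseteq g\}$, where $f\colon A\to\{0,1\}$ and $A\subseteq\kappa$ is countably infinite. *)

theory Defs
  imports "HOL-Analysis.Analysis"
begin

unbundle cardinal_syntax

definition gdelta_modification :: "'a topology \<Rightarrow> 'a topology"
  where "gdelta_modification X = topology_generated_by {S. gdelta_in X S}"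

(* The index set of the power 2^k is the field of the cardinal k; as usual for
   product_topology, points are functions that are undefined outside of it. *)
definition cantor_cube :: "'k rel \<Rightarrow> ('k \<Rightarrow> nat) topology"
  where "cantor_cube \<kappa> = product_topology (\<lambda>_. discrete_topology {0, 1}) (Field \<kappa>)"

definition nowhere_dense_in :: "'a topology \<Rightarrow> 'a set \<Rightarrow> bool"
  where "nowhere_dense_in X S \<longleftrightarrow> S \<subseteq> topspace X \<and> X interior_of (X closure_of S) = {}"

definition dense_in :: "'a topology \<Rightarrow> 'a set \<Rightarrow> bool"
  where "dense_in X S \<longleftrightarrow> S \<subseteq> topspace X \<and> X closure_of S = topspace X"

definition boundary_set_in :: "'a topology \<Rightarrow> 'a set \<Rightarrow> bool"
  where "boundary_set_in X S \<longleftrightarrow> S \<subseteq> topspace X \<and> dense_in X (topspace X - S)"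

end

(* Well-order the given omega_1 many nowhere dense sets so that every initial segment is countable,
   and choose by transfinite recursion an increasing chain of countable partial functions, all
   extending a given one, such that the basic open set of each member of the chain misses the
   corresponding nowhere dense set. Countable unions of countable partial functions keep the
   recursion going. The union of the whole chain may have an uncountable domain and need not
   define an open set, but it is still a partial function, and any total function extending it
   avoids all the given sets. *)

theory Submission
  imports Defs "HOL-Library.Countable_Set_Type"
begin

section \<open>Cylinders of partial functions and of unions of chains\<close>

text \<open>Partial functions are encoded by their graphs; a set of pairs \<open>p\<close> is a partial
  function from \<open>K\<close> to \<open>D\<close> when its cylinder is nonempty (up to harmless pairs \<open>(i, undefined)\<close>
  with \<open>i \<notin> K\<close>).\<close>

definition cylinder :: "'k set \<Rightarrow> 'a set \<Rightarrow> ('k \<times> 'a) set \<Rightarrow> ('k \<Rightarrow> 'a) set"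
  where "cylinder K D p = {g \<in> K \<rightarrow>\<^sub>E D. \<forall>i v. (i, v) \<in> p \<longrightarrow> g i = v}"

lemma cylinder_antimono: "p \<subseteq> q \<Longrightarrow> cylinder K D q \<subseteq> cylinder K D p"
  unfolding cylinder_def by blast

lemma cylinder_Un: "cylinder K D (p \<union> q) = cylinder K D p \<inter> cylinder K D q"
  unfolding cylinder_def by blast

text \<open>Two pairs of \<open>\<Union>C\<close> lie in a common member of the chain, so the union
  is single-valued. No countability enters, so this serves both the countable stages and the final,
  possibly uncountable union.\<close>

lemma cylinder_Union_chain_nonempty:
  assumes chain: "\<And>p q. p \<in> C \<Longrightarrow> q \<in> C \<Longrightarrow> p \<subseteq> q \<or> q \<subseteq> p"
    and nonempty: "\<And>p. p \<in> C \<Longrightarrow> cylinder K D p \<noteq> {}" and "K \<rightarrow>\<^sub>E D \<noteq> {}"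
  shows "cylinder K D (\<Union>C) \<noteq> {}"
proof -
  obtain d where d: "d \<in> K \<rightarrow>\<^sub>E D"
    using assms(3) by blast
  define g where "g i = (if \<exists>v. (i, v) \<in> \<Union>C then SOME v. (i, v) \<in> \<Union>C else d i)" for i
  have single: "v = w" if vw: "(i, v) \<in> \<Union>C" "(i, w) \<in> \<Union>C" for i v w
  proof -
    obtain p where "p \<in> C" "(i, v) \<in> p" "(i, w) \<in> p"
      using vw chain by (meson UnionE subsetD)
    then show ?thesis
      using nonempty[of p] unfolding cylinder_def by blast
  qed
  have g_eq: "g i = v" if "(i, v) \<in> \<Union>C" for i v
    using that single unfolding g_def by (metis (no_types, lifting) someI)
  \<comment> \<open>Membership in \<open>K \<rightarrow>\<^sub>E D\<close> is tested coordinatewise,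
    so it suffices to match some member of the space at each \<open>i\<close>; this covers
    \<open>i \<notin> K\<close> too.\<close>
  have g_local: "\<exists>h \<in> K \<rightarrow>\<^sub>E D. g i = h i" for i
  proof (cases "\<exists>v. (i, v) \<in> \<Union>C")
    case True
    then obtain v p where v: "p \<in> C" "(i, v) \<in> p" by blast
    then obtain h where "h \<in> K \<rightarrow>\<^sub>E D" "h i = v"
      using nonempty[of p] unfolding cylinder_def by blast
    then show ?thesis
      using g_eq[of i v] v by blast
  next
    case False
    then show ?thesis using d by (auto simp: g_def)
  qed
  have "g \<in> K \<rightarrow>\<^sub>E D"
  proof (rule PiE_I)
    show "g i \<in> D" if "i \<in> K" for i
      using g_local[of i] PiE_mem[OF _ that] by auto
    show "g i = undefined" if "i \<notin> K" for i
      using g_local[of i] PiE_arb[OF _ that] by auto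
  qed
  then show ?thesis
    using g_eq unfolding cylinder_def by blast
qed

section \<open>The G_delta-modification of a power of a discrete space\<close>

lemma topspace_gdelta_modification [simp]: "topspace (gdelta_modification X) = topspace X"
  unfolding gdelta_modification_def topology_generated_by_topspace
  by (intro equalityI Union_least Union_upper) (simp_all add: gdelta_in_subset)

context
  fixes K :: "'k set" and D :: "'a set" and X :: "('k \<Rightarrow> 'a) topology"
  defines "X \<equiv> product_topology (\<lambda>_. discrete_topology D) K"
begin

lemma topspace_discrete_product: "topspace X = K \<rightarrow>\<^sub>E D"
  unfolding X_def by simp

lemma openin_discrete_product_cylinder:
  assumes "openin X U" "x \<in> U"
  shows "\<exists>p. finite p \<and> x \<in> cylinder K D p \<and> cylinder K D p \<subseteq> U"
proof -
  obtain V where V: "finite {i \<in> K. V i \<noteq> D}" "\<forall>i\<in>K. V i \<subseteq> D" "x \<in> Pi\<^sub>E K V" "Pi\<^sub>E K V \<subseteq> U"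
    using assms unfolding X_def openin_product_topology_alt by (metis openin_discrete_topology
        topspace_discrete_topology)
  \<comment> \<open>\<open>p\<close> freezes \<open>x\<close> on the finitely many coordinates that
    the box restricts; all other factors are \<open>D\<close>.\<close>
  define p where "p = (\<lambda>i. (i, x i)) ` {i \<in> K. V i \<noteq> D}"
  have "x \<in> cylinder K D p"
    using V(2,3) unfolding cylinder_def p_def by (auto simp: PiE_iff)
  moreover have "cylinder K D p \<subseteq> Pi\<^sub>E K V"
  proof
    fix g assume "g \<in> cylinder K D p"
    then have g: "g \<in> K \<rightarrow>\<^sub>E D" "\<And>i. i \<in> K \<Longrightarrow> V i \<noteq> D \<Longrightarrow> g i = x i"
      unfolding cylinder_def p_def by auto
    then have "g i \<in> V i" if "i \<in> K" for i
      using that V(3) by (metis PiE_mem)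
    then show "g \<in> Pi\<^sub>E K V"
      using g(1) by (simp add: PiE_iff)
  qed
  ultimately show ?thesis
    using V(1,4) p_def by blast
qed

text \<open>Each of the countably many open sets with intersection \<open>S\<close> contributes one
  finite condition; together these form a countable one.\<close>

lemma gdelta_in_discrete_product_cylinder:
  assumes "gdelta_in X S" "x \<in> S"
  shows "\<exists>p. countable p \<and> x \<in> cylinder K D p \<and> cylinder K D p \<subseteq> S"
proof -
  obtain \<U> where \<U>: "countable \<U>" "\<And>U. U \<in> \<U> \<Longrightarrow> openin X U" "\<Inter>\<U> = S"
    using assms(1) unfolding gdelta_in_alt intersection_of_def by blast
  have "\<forall>U\<in>\<U>. \<exists>p. finite p \<and> x \<in> cylinder K D p \<and> cylinder K D p \<subseteq> U"
    using \<U> assms(2) openin_discrete_product_cylinder by blast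
  then obtain p where p: "\<And>U. U \<in> \<U> \<Longrightarrow> finite (p U) \<and> x \<in> cylinder K D (p U) \<and> cylinder K D (p U) \<subseteq> U"
    by metis
  have "x \<in> K \<rightarrow>\<^sub>E D"
    using assms gdelta_in_subset topspace_discrete_product by blast
  then have "x \<in> cylinder K D (\<Union>(p ` \<U>))"
    using p unfolding cylinder_def by blast
  moreover have "cylinder K D (\<Union>(p ` \<U>)) \<subseteq> S"
    using p \<U>(3) cylinder_antimono[of "p _" "\<Union>(p ` \<U>)"] by blast
  moreover have "countable (\<Union>(p ` \<U>))"
    using p \<U>(1) by (blast intro: countable_finite)
  ultimately show ?thesis by blast
qed

text \<open>Having the cylinder of a countable \<open>p\<close> around each point passes from
  G_delta sets to finite intersections and to unions, hence to the generated topology. With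
  \<open>openin_cylinder\<close>, these cylinders form a base.\<close>

lemma openin_gdelta_modification_cylinder:
  assumes "openin (gdelta_modification X) U" "x \<in> U"
  shows "\<exists>p. countable p \<and> x \<in> cylinder K D p \<and> cylinder K D p \<subseteq> U"
proof -
  have "generate_topology_on {S. gdelta_in X S} U"
    using assms(1) unfolding gdelta_modification_def openin_topology_generated_by_iff .
  then show ?thesis
    using assms(2)
  proof (induction arbitrary: x)
    case (Int a b)
    then obtain p q where "countable p" "x \<in> cylinder K D p" "cylinder K D p \<subseteq> a"
      "countable q" "x \<in> cylinder K D q" "cylinder K D q \<subseteq> b"
      by (meson IntD1 IntD2)
    then show ?case
      by (intro exI[of _ "p \<union> q"]) (auto simp: cylinder_Un)
  next
    case (UN \<K>)
    then show ?case by (meson Sup_upper UnionE order_trans)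
  qed (use gdelta_in_discrete_product_cylinder in auto)
qed

lemma openin_cylinder:
  assumes "countable p"
  shows "openin (gdelta_modification X) (cylinder K D p)"
proof -
  have "openin X {g \<in> K \<rightarrow>\<^sub>E D. g i = v}" for i v
  proof (cases "i \<in> K")
    case True
    then have "openin X {g \<in> topspace X. g i \<in> {v} \<inter> D}"
      unfolding X_def
      by (intro openin_continuous_map_preimage[OF continuous_map_product_projection]) auto
    moreover have "{g \<in> topspace X. g i \<in> {v} \<inter> D} = {g \<in> K \<rightarrow>\<^sub>E D. g i = v}"
      using True by (auto simp: topspace_discrete_product)
    ultimately show ?thesis by simp
  next
    case False
    \<comment> \<open>All points take the value \<open>undefined\<close> outside \<open>K\<close>,
      so such a condition is void or contradictory.\<close>
    then have "{g \<in> K \<rightarrow>\<^sub>E D. g i = v} = (if v = undefined then topspace X else {})"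
      by (auto simp: topspace_discrete_product)
    then show ?thesis by simp
  qed
  \<comment> \<open>Adding \<open>topspace X\<close> keeps the family nonempty when \<open>p\<close>
    is empty.\<close>
  then have "gdelta_in X (\<Inter>(insert (topspace X) ((\<lambda>(i, v). {g \<in> K \<rightarrow>\<^sub>E D. g i = v}) ` p)))"
    using assms by (intro gdelta_in_Inter) (auto intro: open_imp_gdelta_in)
  moreover have "\<Inter>(insert (topspace X) ((\<lambda>(i, v). {g \<in> K \<rightarrow>\<^sub>E D. g i = v}) ` p)) = cylinder K D p"
    unfolding cylinder_def topspace_discrete_product by auto
  ultimately show ?thesis
    unfolding gdelta_modification_def by (simp add: topology_generated_by_Basis)
qed

section \<open>Avoiding nowhere dense sets by extending partial functions\<close>

lemma nowhere_dense_avoiding_extension: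
  assumes "nowhere_dense_in (gdelta_modification X) S" "countable p" "cylinder K D p \<noteq> {}"
  shows "\<exists>q. p \<subseteq> q \<and> countable q \<and> cylinder K D q \<noteq> {} \<and> cylinder K D q \<inter> S = {}"
proof -
  let ?Y = "gdelta_modification X"
  have S: "S \<subseteq> ?Y closure_of S" "?Y interior_of (?Y closure_of S) = {}"
    using assms(1) closure_of_subset unfolding nowhere_dense_in_def by blast+
  \<comment> \<open>A nonempty open cylinder does not fit into a closure with empty interior; what
    sticks out is open and has room for a smaller cylinder.\<close>
  then have "\<not> cylinder K D p \<subseteq> ?Y closure_of S"
    using interior_of_maximal[OF _ openin_cylinder[OF assms(2)]] assms(3) by blast
  then obtain x where x: "x \<in> cylinder K D p - ?Y closure_of S"
    by blast
  have "openin ?Y (cylinder K D p - ?Y closure_of S)"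
    using openin_cylinder[OF assms(2)] by (simp add: openin_diff)
  then obtain q where "countable q" "x \<in> cylinder K D q"
    "cylinder K D q \<subseteq> cylinder K D p - ?Y closure_of S"
    using openin_gdelta_modification_cylinder x by blast
  \<comment> \<open>Passing to \<open>p \<union> q\<close> gives inclusion of graphs, which
    inclusion of cylinders alone need not give; \<open>x\<close> keeps the new cylinder
    nonempty.\<close>
  then show ?thesis
    using assms(2) x S(1) by (intro exI[of _ "p \<union> q"]) (auto simp: cylinder_Un)
qed

lemma omega1_Union_nowhere_dense_avoided:
  assumes card: "|\<F>| \<le>o cardSuc natLeq"
    and nd: "\<And>S. S \<in> \<F> \<Longrightarrow> nowhere_dense_in (gdelta_modification X) S"
    and p0: "countable p0" "cylinder K D p0 \<noteq> {}"
  shows "cylinder K D p0 - \<Union>\<F> \<noteq> {}"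
proof -
  define R where "R = |\<F>| - Id"
  have wo: "well_order_on \<F> |\<F>|"
    by (rule card_of_well_order_on)
  have wf: "wf R"
    using wo unfolding R_def well_order_on_def by blast
  have trans: "trans |\<F>|" and antisym: "antisym |\<F>|" and total: "total_on \<F> |\<F>|"
    using wo unfolding well_order_on_def linear_order_on_def partial_order_on_def preorder_on_def
    by auto
  have R_field: "S \<in> \<F> \<and> T \<in> \<F>" if "(S, T) \<in> R" for S T
    using that FieldI1 FieldI2 unfolding R_def by (metis DiffD1 Field_card_of)
  have R_trans: "(S, U) \<in> R" if "(S, T) \<in> R" "(T, U) \<in> R" for S T U
    using that trans antisym unfolding R_def by (auto dest: transD antisymD)
  have R_total: "(S, T) \<in> R \<or> S = T \<or> (T, S) \<in> R" if "S \<in> \<F>" "T \<in> \<F>" for S T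
    using that total unfolding R_def total_on_def by auto
  \<comment> \<open>The order of \<open>|\<F>|\<close> is a cardinal, so its proper initial segments
    have smaller cardinality; being below the successor of aleph_0 means being countable.\<close>
  have R_countable: "countable {T. (T, S) \<in> R}" for S
  proof (cases "S \<in> \<F>")
    case True
    then have "S \<in> Field ( |\<F>| )"
      by (simp add: Field_card_of)
    from ordLess_ordLeq_trans[OF card_of_underS[OF card_of_Card_order this] card]
    have "countable (underS ( |\<F>| ) S)"
      unfolding countable_card_le_natLeq
        cardSuc_ordLeq_ordLess[OF natLeq_Card_order card_of_Card_order] .
    moreover have "{T. (T, S) \<in> R} = underS ( |\<F>| ) S"
      by (auto simp: R_def underS_def)
    ultimately show ?thesis by simp
  next
    case False
    then have "{T. (T, S) \<in> R} = {}"
      using R_field by blast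
    then show ?thesis by simp
  qed
  \<comment> \<open>Including \<open>p0\<close> makes every stage extend it, the first one
    too.\<close>
  define below where "below f S = insert p0 (f ` {T. (T, S) \<in> R})"
    for f :: "('k \<Rightarrow> 'a) set \<Rightarrow> ('k \<times> 'a) set" and S
  \<comment> \<open>The recursion ranges over all sets \<open>S\<close>, so avoidance is asked only
    for \<open>S \<in> \<F>\<close>; any other \<open>S\<close> has no \<open>R\<close>-predecessors
    and \<open>p0\<close> itself fits.\<close>
  define P where "P f S q \<longleftrightarrow> \<Union>(below f S) \<subseteq> q \<and> countable q \<and> cylinder K D q \<noteq> {}
      \<and> (S \<in> \<F> \<longrightarrow> cylinder K D q \<inter> S = {})" for f S q
  have space: "K \<rightarrow>\<^sub>E D \<noteq> {}"
    using p0(2) unfolding cylinder_def by blast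
  have "\<exists>f. \<forall>S. P f S (f S)"
  proof (rule dependent_wf_choice[OF wf])
    fix f g :: "('k \<Rightarrow> 'a) set \<Rightarrow> ('k \<times> 'a) set" and S q
    assume "\<And>T. (T, S) \<in> R \<Longrightarrow> f T = g T"
    then have "below f S = below g S"
      unfolding below_def by (auto simp: image_def)
    then show "P f S q = P g S q"
      unfolding P_def by simp
  next
    fix S f
    assume IH: "\<And>T. (T, S) \<in> R \<Longrightarrow> P f T (f T)"
    have mono: "f T \<subseteq> f T'" if "(T, T') \<in> R" "(T', S) \<in> R" for T T'
      using IH[OF that(2)] that(1) unfolding P_def below_def by blast
    have "cylinder K D (\<Union>(below f S)) \<noteq> {}"
    proof (rule cylinder_Union_chain_nonempty[OF _ _ space])
      fix p q assume pq: "p \<in> below f S" "q \<in> below f S"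
      have "p0 \<subseteq> f T" if "(T, S) \<in> R" for T
        using IH[OF that] unfolding P_def below_def by blast
      then show "p \<subseteq> q \<or> q \<subseteq> p"
        using pq mono R_total R_field unfolding below_def by blast
    next
      fix p assume "p \<in> below f S"
      then show "cylinder K D p \<noteq> {}"
        using IH p0(2) unfolding below_def P_def by blast
    qed
    moreover have "countable (\<Union>(below f S))"
      using IH p0(1) R_countable[of S] unfolding below_def P_def
      by auto
    \<comment> \<open>For \<open>S \<in> \<F>\<close> the union of the earlier stages is extended so
      as to avoid \<open>S\<close>; otherwise that union itself serves.\<close>
    ultimately show "\<exists>q. P f S q"
      using nowhere_dense_avoiding_extension nd unfolding P_def by (metis order_refl)
  qed
  then obtain f where f: "\<And>S. P f S (f S)"
    by blast
  have f_mono: "f S \<subseteq> f T" if "(S, T) \<in> R" for S T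
    using f[of T] that unfolding P_def below_def by blast
  have f_p0: "p0 \<subseteq> f S" for S
    using f[of S] unfolding P_def below_def by blast
  have "cylinder K D (\<Union>(insert p0 (f ` \<F>))) \<noteq> {}"
  proof (rule cylinder_Union_chain_nonempty[OF _ _ space])
    show "p \<subseteq> q \<or> q \<subseteq> p" if "p \<in> insert p0 (f ` \<F>)" "q \<in> insert p0 (f ` \<F>)" for p q
      using that R_total f_mono f_p0 by blast
    show "cylinder K D p \<noteq> {}" if "p \<in> insert p0 (f ` \<F>)" for p
      using that f p0(2) unfolding P_def by blast
  qed
  then obtain g where g: "g \<in> cylinder K D (\<Union>(insert p0 (f ` \<F>)))"
    by blast
  have "g \<in> cylinder K D p0"
    using g cylinder_antimono[of p0 "\<Union>(insert p0 (f ` \<F>))"] by blast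
  moreover have "g \<notin> S" if "S \<in> \<F>" for S
  proof -
    have "g \<in> cylinder K D (f S)"
      using g that cylinder_antimono[of "f S" "\<Union>(insert p0 (f ` \<F>))"] by blast
    then show ?thesis
      using f[of S] that unfolding P_def by blast
  qed
  ultimately show ?thesis by blast
qed

text \<open>Every nonempty open set contains a nonempty cylinder of a countable \<open>p\<close>,
  which becomes the starting condition of the recursion.\<close>

lemma omega1_Union_nowhere_dense_boundary:
  assumes "|\<F>| \<le>o cardSuc natLeq"
    and nd: "\<And>S. S \<in> \<F> \<Longrightarrow> nowhere_dense_in (gdelta_modification X) S"
  shows "boundary_set_in (gdelta_modification X) (\<Union>\<F>)"
proof -
  let ?Y = "gdelta_modification X"
  have "(topspace ?Y - \<Union>\<F>) \<inter> U \<noteq> {}" if U: "openin ?Y U" "U \<noteq> {}" for U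
  proof -
    obtain x where "x \<in> U"
      using U(2) by blast
    then obtain p where p: "countable p" "x \<in> cylinder K D p" "cylinder K D p \<subseteq> U"
      using openin_gdelta_modification_cylinder[OF U(1)] by blast
    then have "cylinder K D p - \<Union>\<F> \<noteq> {}"
      by (intro omega1_Union_nowhere_dense_avoided[OF assms]) auto
    then show ?thesis
      using p(3) openin_subset[OF U(1)] by blast
  qed
  moreover have "\<Union>\<F> \<subseteq> topspace ?Y"
    using nd unfolding nowhere_dense_in_def by blast
  ultimately show ?thesis
    unfolding boundary_set_in_def dense_in_def dense_intersects_open
    by (simp del: topspace_gdelta_modification)
qed

end

theorem proposition7:
  fixes \<kappa> :: "'k rel" and \<F> :: "('k \<Rightarrow> nat) set set"
  assumes "Card_order \<kappa>" and "natLeq <o \<kappa>"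
    and "|\<F>| \<le>o cardSuc natLeq"
    and "\<And>S. S \<in> \<F> \<Longrightarrow> nowhere_dense_in (gdelta_modification (cantor_cube \<kappa>)) S"
  shows "boundary_set_in (gdelta_modification (cantor_cube \<kappa>)) (\<Union>\<F>)"
  \<comment> \<open>The cube is the discrete power with \<open>K = Field \<kappa>\<close> and
    \<open>D = {0, 1}\<close>.\<close>
  using assms(3,4) unfolding cantor_cube_def by (rule omega1_Union_nowhere_dense_boundary)

end
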